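(* Let $(S,\mathcal B,\mu)$, $G$ and the non-singular $G$-action $\mathcal G=\{\phi_t\}_{t\in G}$ be as in the context, let $P_{\mathcal G}$ be the (mod $\mu$ unique) maximal element of $I(\mathcal G)$ and $N_{\mathcal G}=S\setminus P_{\mathcal G}$. Let $f\in L^1(S,\mu)$ with $f>0$. Then: (i) for all $t\in G$, $\mu(\phi_t^{-1}(P_{\mathcal G})\triangle P_{\mathcal G})=0$ and $\mu(\phi_t^{-1}(N_{\mathcal G})\triangle N_{\mathcal G})=0$; (ii) for every sequence $\{u_n\}_{n\in\mathbb N}\subset G$, $\sum_{n=1}^\infty \widehat\phi_{u_n}f(s)=\infty$ for $\mu$-a.e. $s\in P_{\mathcal G}$; (iii) there exists a sequence $\{u_n\}_{n\in\mathbb N}\subset G$ such that $\sum_{n=1}^\infty \widehat\phi_{u_n}f(s)<\infty$ for $\mu$-a.e. $s\in N_{\mathcal G}$.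
   Context: $(S,\mathcal B,\mu)$ is a standard Lebesgue space with $\sigma$-finite $\mu$; $G$ is a locally compact abelian topological group. A map $\phi$ is non-singular if it is invertible, bi-measurable and $\mu\circ\phi^{-1}\sim\mu$. A $G$-action is a family $\{\phi_t\}_{t\in G}$ of measurable maps with $\phi_0=\mathrm{id}$, $\phi_{u+v}=\phi_u\circ\phi_v$, and $(s,u)\mapsto\phi_u(s)$ jointly measurable; non-singular if each $\phi_t$ is. The dual operator of a non-singular $\phi$ is $\widehat\phi f(s)=\frac{d\mu\circ\phi^{-1}}{d\mu}(s)\,f(\phi^{-1}(s))$ for $f\in L^1(S,\mu)$. $\Lambda(\mathcal G)$ is the set of finite measures $\nu\ll\mu$ with $\nu\circ\phi_t^{-1}=\nu$ for all $t$; $S_\nu=\{d\nu/d\mu>0\}$; $I(\mathcal G)=\{S_\nu:\nu\in\Lambda(\mathcal G)\}$; its maximal element mod $\mu$ is a set $P_{\mathcal G}\in I(\mathcal G)$ with $\mu(S_\nu\setminus P_{\mathcal G})=0$ for all $S_\nu\in I(\mathcal G)$ (it exists and is unique mod $\mu$). $P_{\mathcal G}$ and $N_{\mathcal G}$ are called the positive and null parts; $\mathcal G$ is called positive if $\mu(N_{\mathcal G})=0$ and null if $\mu(P_{\mathcal G})=0$. *)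

theory Defs
  imports "HOL-Analysis.Analysis" "HOL-Probability.Probability"
begin

definition nonsingular :: "'s measure \<Rightarrow> ('s \<Rightarrow> 's) \<Rightarrow> bool" where
  "nonsingular M \<phi> \<longleftrightarrow>
     bij_betw \<phi> (space M) (space M) \<and>
     \<phi> \<in> measurable M M \<and> inv_into (space M) \<phi> \<in> measurable M M \<and>
     (\<forall>A\<in>sets M. emeasure (distr M M \<phi>) A = 0 \<longleftrightarrow> emeasure M A = 0)"

definition nonsingular_action :: "'s measure \<Rightarrow> ('g::{topological_space, ab_group_add} \<Rightarrow> 's \<Rightarrow> 's) \<Rightarrow> bool" where
  "nonsingular_action M \<phi> \<longleftrightarrow>
     (\<forall>s\<in>space M. \<phi> 0 s = s) \<and>
     (\<forall>u v. \<forall>s\<in>space M. \<phi> (u + v) s = \<phi> u (\<phi> v s)) \<and>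
     (\<lambda>(s, u). \<phi> u s) \<in> measurable (M \<Otimes>\<^sub>M borel) M \<and>
     (\<forall>t. nonsingular M (\<phi> t))"

text \<open>Dual operator of a non-singular map (values in ennreal, f nonnegative here).\<close>
definition dual_op :: "'s measure \<Rightarrow> ('s \<Rightarrow> 's) \<Rightarrow> ('s \<Rightarrow> real) \<Rightarrow> 's \<Rightarrow> ennreal" where
  "dual_op M \<phi> f s = RN_deriv M (distr M M \<phi>) s * ennreal (f (inv_into (space M) \<phi> s))"

definition Lambda_inv :: "'s measure \<Rightarrow> ('g \<Rightarrow> 's \<Rightarrow> 's) \<Rightarrow> 's measure set" where
  "Lambda_inv M \<phi> = {\<nu>. sets \<nu> = sets M \<and> finite_measure \<nu> \<and> absolutely_continuous M \<nu> \<and>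
                        (\<forall>t. distr \<nu> M (\<phi> t) = \<nu>)}"

definition I_inv :: "'s measure \<Rightarrow> ('g \<Rightarrow> 's \<Rightarrow> 's) \<Rightarrow> 's set set" where
  "I_inv M \<phi> = {{s \<in> space M. 0 < h s} | h \<nu>.
       \<nu> \<in> Lambda_inv M \<phi> \<and> h \<in> borel_measurable M \<and> \<nu> = density M h}"

definition positive_part :: "'s measure \<Rightarrow> ('g \<Rightarrow> 's \<Rightarrow> 's) \<Rightarrow> 's set \<Rightarrow> bool" where
  "positive_part M \<phi> P \<longleftrightarrow> P \<in> I_inv M \<phi> \<and>
     (\<forall>S\<in>I_inv M \<phi>. emeasure M (S - P) = 0)"

definition symdiff :: "'a set \<Rightarrow> 'a set \<Rightarrow> 'a set" where
  "symdiff A B = (A - B) \<union> (B - A)"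

end

theory Submission
  imports Defs
begin

text \<open>
  On the positive part, with invariant density \<open>h\<close>, the ratio \<open>T\<^sub>u f / h\<close>, where \<open>T\<^sub>u\<close> is the dual operator, equals
  \<open>(f / h) \<circ> \<phi>\<^sub>u\<inverse>\<close>. Where the series converges these ratios fall below every \<open>\<epsilon>\<close>, so by invariance of
  \<open>h\<mu>\<close> this set has \<open>h\<mu>\<close>-measure at most that of \<open>{f < \<epsilon> h}\<close>, which tends to \<open>0\<close>.

  On the null part \<open>N\<close> consider the unitary Koopman operators \<open>U\<^sub>t h = sqrt (d\<mu>\<circ>\<phi>\<^sub>t\<inverse>/d\<mu>) \<cdot> (h \<circ> \<phi>\<^sub>t\<inverse>)\<close> of
  \<open>L\<^sup>2(\<mu>)\<close> and \<open>g = sqrt f \<cdot> 1\<^sub>N\<close>. If \<open>\<langle>g, U\<^sub>t g\<rangle> \<ge> c > 0\<close> for all \<open>t\<close>, then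
  \<open>{h. \<forall>t. \<langle>h, U\<^sub>t g\<rangle> \<ge> c}\<close> is a nonempty closed convex set invariant under every \<open>U\<^sub>t\<close>, so its element
  \<open>h\<close> of minimal norm is fixed by every \<open>U\<^sub>t\<close>; then \<open>h\<^sup>2\<mu>\<close> is a finite invariant measure that charges
  \<open>N\<close>, a contradiction. Hence one can choose \<open>u(n)\<close> with \<open>\<langle>g, U\<^bsub>u(n)\<^esub> g\<rangle> < 2\<^bsup>-n\<^esup>\<close>; then
  \<open>\<Sum>\<^sub>n sqrt (f \<cdot> T\<^bsub>u(n)\<^esub> f)\<close> converges almost everywhere on \<open>N\<close>, and therefore so does \<open>\<Sum>\<^sub>n T\<^bsub>u(n)\<^esub> f\<close>.
\<close>

section \<open>Elements of minimal norm in square-integrable functions\<close>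

text \<open>Elements of L2 are kept as functions instead of classes modulo null sets, so equality of
  vectors appears below as equality almost everywhere.\<close>

definition sq_integrable :: "'a measure \<Rightarrow> ('a \<Rightarrow> real) \<Rightarrow> bool" where
  "sq_integrable M h \<longleftrightarrow> h \<in> borel_measurable M \<and> integrable M (\<lambda>x. (h x)\<^sup>2)"

lemma sq_integrable_integrable_square:
  "sq_integrable M h \<Longrightarrow> integrable M (\<lambda>x. (h x)\<^sup>2)"
  by (simp add: sq_integrable_def)

lemma sq_integrable_integrable_mult:
  assumes "sq_integrable M h" "sq_integrable M k"
  shows "integrable M (\<lambda>x. h x * k x)"
proof (rule Bochner_Integration.integrable_bound)
  show "integrable M (\<lambda>x. (h x)\<^sup>2 + (k x)\<^sup>2)"
    using assms by (simp add: sq_integrable_def)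
  show "(\<lambda>x. h x * k x) \<in> borel_measurable M"
    using assms by (auto simp: sq_integrable_def)
  have "\<bar>a * b\<bar> \<le> a\<^sup>2 + b\<^sup>2" for a b :: real
    using sum_squares_bound[of "\<bar>a\<bar>" "\<bar>b\<bar>"] zero_le_mult_iff[of "\<bar>a\<bar>" "\<bar>b\<bar>"]
    unfolding abs_mult power2_abs by linarith
  then show "AE x in M. norm (h x * k x) \<le> norm ((h x)\<^sup>2 + (k x)\<^sup>2)"
    by auto
qed

lemma sq_integrable_cmult:
  "sq_integrable M h \<Longrightarrow> sq_integrable M (\<lambda>x. c * h x)"
  by (auto simp: sq_integrable_def power_mult_distrib)

lemma sq_integrable_add:
  assumes "sq_integrable M h" "sq_integrable M k"
  shows "sq_integrable M (\<lambda>x. h x + k x)"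
  using assms sq_integrable_integrable_mult[OF assms]
  by (auto simp: sq_integrable_def power2_sum mult.assoc)

lemma sq_integrable_diff:
  assumes "sq_integrable M h" "sq_integrable M k"
  shows "sq_integrable M (\<lambda>x. h x - k x)"
  using sq_integrable_add[OF assms(1) sq_integrable_cmult[OF assms(2), of "-1"]] by simp

section \<open>Inner products and completeness in L2\<close>

lemma integral_mult_le_Cauchy_Schwarz:
  assumes h: "sq_integrable M h" and k: "sq_integrable M k"
  shows "(\<integral>x. h x * k x \<partial>M)\<^sup>2 \<le> (\<integral>x. (h x)\<^sup>2 \<partial>M) * (\<integral>x. (k x)\<^sup>2 \<partial>M)"
proof -
  have int: "integrable M (\<lambda>x. \<bar>h x\<bar> * \<bar>k x\<bar>)"
    using sq_integrable_integrable_mult[OF h k, THEN integrable_abs] by (simp add: abs_mult)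
  have "(\<integral>\<^sup>+x. ennreal \<bar>h x\<bar> * ennreal \<bar>k x\<bar> \<partial>M)\<^sup>2
      \<le> (\<integral>\<^sup>+x. (ennreal \<bar>h x\<bar>)\<^sup>2 \<partial>M) * (\<integral>\<^sup>+x. (ennreal \<bar>k x\<bar>)\<^sup>2 \<partial>M)"
    using h k by (intro Cauchy_Schwarz_nn_integral) (auto simp: sq_integrable_def)
  also have "(\<integral>\<^sup>+x. ennreal \<bar>h x\<bar> * ennreal \<bar>k x\<bar> \<partial>M) = ennreal (\<integral>x. \<bar>h x\<bar> * \<bar>k x\<bar> \<partial>M)"
    using int by (simp add: ennreal_mult'[symmetric] nn_integral_eq_integral)
  also have "(\<integral>\<^sup>+x. (ennreal \<bar>h x\<bar>)\<^sup>2 \<partial>M) = ennreal (\<integral>x. (h x)\<^sup>2 \<partial>M)"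
    using h by (simp add: ennreal_power nn_integral_eq_integral sq_integrable_def)
  also have "(\<integral>\<^sup>+x. (ennreal \<bar>k x\<bar>)\<^sup>2 \<partial>M) = ennreal (\<integral>x. (k x)\<^sup>2 \<partial>M)"
    using k by (simp add: ennreal_power nn_integral_eq_integral sq_integrable_def)
  finally have "(\<integral>x. \<bar>h x\<bar> * \<bar>k x\<bar> \<partial>M)\<^sup>2 \<le> (\<integral>x. (h x)\<^sup>2 \<partial>M) * (\<integral>x. (k x)\<^sup>2 \<partial>M)"
    by (simp add: ennreal_power ennreal_mult'[symmetric] ennreal_le_iff)
  moreover have "\<bar>\<integral>x. h x * k x \<partial>M\<bar> \<le> (\<integral>x. \<bar>h x\<bar> * \<bar>k x\<bar> \<partial>M)"
    using integral_abs_bound[of M "\<lambda>x. h x * k x"] by (simp add: abs_mult)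
  then have "(\<integral>x. h x * k x \<partial>M)\<^sup>2 \<le> (\<integral>x. \<bar>h x\<bar> * \<bar>k x\<bar> \<partial>M)\<^sup>2"
    by (metis abs_ge_zero power2_abs power_mono)
  ultimately show ?thesis by linarith
qed

text \<open>Cauchy-Schwarz for \<open>h n - k\<close> and \<open>l\<close>. This makes half-spaces
  closed under L2 limits and later gives the norm bound for the limit of a minimising
  sequence.\<close>

lemma tendsto_integral_mult_L2:
  assumes h: "\<And>n. sq_integrable M (h n)" and k: "sq_integrable M k" and l: "sq_integrable M l"
    and lim: "(\<lambda>n. \<integral>x. (h n x - k x)\<^sup>2 \<partial>M) \<longlonglongrightarrow> 0"
  shows "(\<lambda>n. \<integral>x. h n x * l x \<partial>M) \<longlonglongrightarrow> (\<integral>x. k x * l x \<partial>M)"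
proof -
  have "(\<lambda>n. sqrt ((\<integral>x. (h n x - k x)\<^sup>2 \<partial>M) * (\<integral>x. (l x)\<^sup>2 \<partial>M))) \<longlonglongrightarrow> sqrt (0 * (\<integral>x. (l x)\<^sup>2 \<partial>M))"
    by (intro tendsto_intros lim)
  then have "(\<lambda>n. sqrt ((\<integral>x. (h n x - k x)\<^sup>2 \<partial>M) * (\<integral>x. (l x)\<^sup>2 \<partial>M))) \<longlonglongrightarrow> 0"
    by simp
  then have "(\<lambda>n. (\<integral>x. h n x * l x \<partial>M) - (\<integral>x. k x * l x \<partial>M)) \<longlonglongrightarrow> 0"
  proof (rule Lim_null_comparison[OF always_eventually, rotated], intro allI)
    fix n
    have "(\<integral>x. h n x * l x \<partial>M) - (\<integral>x. k x * l x \<partial>M) = (\<integral>x. (h n x - k x) * l x \<partial>M)"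
      using sq_integrable_integrable_mult[OF h l] sq_integrable_integrable_mult[OF k l]
      by (simp add: left_diff_distrib)
    then show "norm ((\<integral>x. h n x * l x \<partial>M) - (\<integral>x. k x * l x \<partial>M))
      \<le> sqrt ((\<integral>x. (h n x - k x)\<^sup>2 \<partial>M) * (\<integral>x. (l x)\<^sup>2 \<partial>M))"
      using integral_mult_le_Cauchy_Schwarz[OF sq_integrable_diff[OF h k] l, of n]
      by (simp add: real_le_rsqrt)
  qed
  then show ?thesis by (simp add: LIM_zero_iff)
qed

text \<open>The squared increments weighted by \<open>4^n\<close> have integrals at most
  \<open>(1/4)^n\<close>, so their sum is finite almost everywhere. At such a point the increments
  are O(2^-n), and telescoping gives convergence.\<close>

lemma AE_convergent_if_rapidly_Cauchy_L2:
  fixes h :: "nat \<Rightarrow> 'a \<Rightarrow> real"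
  assumes h: "\<And>n. sq_integrable M (h n)"
    and Cauchy: "\<And>n. (\<integral>x. (h (Suc n) x - h n x)\<^sup>2 \<partial>M) \<le> (1/16)^n"
  shows "AE x in M. convergent (\<lambda>n. h n x)"
proof -
  have [measurable]: "h n \<in> borel_measurable M" for n
    using h by (simp add: sq_integrable_def)
  have nn: "(\<integral>\<^sup>+x. ennreal (4^n * (h (Suc n) x - h n x)\<^sup>2) \<partial>M) \<le> ennreal ((1/4)^n)" for n
  proof -
    have "(\<integral>\<^sup>+x. ennreal (4^n * (h (Suc n) x - h n x)\<^sup>2) \<partial>M)
        = ennreal (\<integral>x. 4^n * (h (Suc n) x - h n x)\<^sup>2 \<partial>M)"
      using sq_integrable_diff[OF h h, of "Suc n" n]
      by (intro nn_integral_eq_integral) (auto simp: sq_integrable_def)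
    also have "\<dots> = ennreal (4^n * (\<integral>x. (h (Suc n) x - h n x)\<^sup>2 \<partial>M))" by simp
    also have "\<dots> \<le> ennreal (4^n * (1/16)^n)"
      by (intro ennreal_leI mult_left_mono Cauchy) auto
    also have "(4::real)^n * (1/16)^n = (1/4)^n"
      by (simp add: power_mult_distrib[symmetric])
    finally show ?thesis .
  qed
  have "(\<integral>\<^sup>+x. (\<Sum>n. ennreal (4^n * (h (Suc n) x - h n x)\<^sup>2)) \<partial>M)
      = (\<Sum>n. \<integral>\<^sup>+x. ennreal (4^n * (h (Suc n) x - h n x)\<^sup>2) \<partial>M)"
    by (intro nn_integral_suminf) auto
  also have "\<dots> \<le> (\<Sum>n. ennreal ((1/4)^n))"
    by (intro suminf_le nn) auto
  also have "\<dots> < \<infinity>"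
    by (subst suminf_ennreal2) (auto intro!: summable_geometric)
  finally have "AE x in M. (\<Sum>n. ennreal (4^n * (h (Suc n) x - h n x)\<^sup>2)) \<noteq> \<infinity>"
    by (intro nn_integral_PInf_AE) auto
  then show ?thesis
  proof eventually_elim
    case (elim x)
    have "summable (\<lambda>n. 4^n * (h (Suc n) x - h n x)\<^sup>2)"
      using elim by (intro summable_suminf_not_top) auto
    then have "Bseq (\<lambda>n. 4^n * (h (Suc n) x - h n x)\<^sup>2)"
      by (intro convergent_imp_Bseq) (blast intro: convergentI summable_LIMSEQ_zero)
    then obtain K where K: "\<And>n. \<bar>4^n * (h (Suc n) x - h n x)\<^sup>2\<bar> \<le> K"
      by (auto simp: Bseq_def)
    have "\<bar>h (Suc n) x - h n x\<bar> \<le> sqrt K * (1/2)^n" for n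
    proof -
      have "(2^n * \<bar>h (Suc n) x - h n x\<bar>)\<^sup>2 \<le> K"
        using K[of n] by (simp add: power_mult_distrib power2_eq_square[of "2^n"] flip: power_mult_distrib[of 2 2])
      then have "2^n * \<bar>h (Suc n) x - h n x\<bar> \<le> sqrt K"
        by (rule real_le_rsqrt)
      then show ?thesis by (simp add: field_simps power_one_over)
    qed
    then have "\<exists>N. \<forall>n\<ge>N. norm (h (Suc n) x - h n x) \<le> sqrt K * (1/2)^n"
      by simp
    moreover have "summable (\<lambda>n. sqrt K * (1/2)^n)"
      by (rule summable_mult[OF summable_geometric]) simp
    ultimately have "summable (\<lambda>n. h (Suc n) x - h n x)"
      by (rule summable_comparison_test)
    then have "convergent (\<lambda>n. h n x - h 0 x)"
      unfolding summable_iff_convergent sum_lessThan_telescope[of "\<lambda>n. h n x"] .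
    then show ?case
      by (simp only: convergent_diff_const_right_iff)
  qed
qed

text \<open>The limit is taken pointwise, and Fatou's lemma carries the bound on
  \<open>h m - h n\<close> over to \<open>k - h n\<close>. Imposing a rate is harmless, because a
  minimising sequence can be chosen to meet it.\<close>

lemma rapidly_Cauchy_L2_complete:
  fixes h :: "nat \<Rightarrow> 'a \<Rightarrow> real"
  assumes h: "\<And>n. sq_integrable M (h n)"
    and Cauchy: "\<And>n m. n \<le> m \<Longrightarrow> (\<integral>x. (h m x - h n x)\<^sup>2 \<partial>M) \<le> (1/16)^n"
  obtains k where "sq_integrable M k" "(\<lambda>n. \<integral>x. (h n x - k x)\<^sup>2 \<partial>M) \<longlonglongrightarrow> 0"
proof -
  have [measurable]: "h n \<in> borel_measurable M" for n
    using h by (simp add: sq_integrable_def)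
  \<comment> \<open>On the null set of divergence \<open>lim\<close> has an unspecified value, which
    affects neither measurability nor the integrals.\<close>
  define k where "k = (\<lambda>x. lim (\<lambda>n. h n x))"
  have k_meas [measurable]: "k \<in> borel_measurable M"
    unfolding k_def by measurable
  have conv: "AE x in M. (\<lambda>n. h n x) \<longlonglongrightarrow> k x"
    using AE_convergent_if_rapidly_Cauchy_L2[OF h Cauchy] by (simp add: convergent_LIMSEQ_iff k_def)
  have bound: "(\<integral>\<^sup>+x. ennreal ((h n x - k x)\<^sup>2) \<partial>M) \<le> ennreal ((1/16)^n)" for n
  proof -
    have "(\<integral>\<^sup>+x. ennreal ((h n x - k x)\<^sup>2) \<partial>M)
        = (\<integral>\<^sup>+x. liminf (\<lambda>m. ennreal ((h m x - h n x)\<^sup>2)) \<partial>M)"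
      using conv
    proof (intro nn_integral_cong_AE, eventually_elim)
      case (elim x)
      have "(\<lambda>m. ennreal ((h m x - h n x)\<^sup>2)) \<longlonglongrightarrow> ennreal ((k x - h n x)\<^sup>2)"
        by (intro tendsto_intros elim)
      then have "liminf (\<lambda>m. ennreal ((h m x - h n x)\<^sup>2)) = ennreal ((k x - h n x)\<^sup>2)"
        by (intro lim_imp_Liminf) auto
      then show ?case by (simp add: power2_commute)
    qed
    also have "\<dots> \<le> liminf (\<lambda>m. \<integral>\<^sup>+x. ennreal ((h m x - h n x)\<^sup>2) \<partial>M)"
      by (intro nn_integral_liminf) auto
    also have "\<dots> \<le> liminf (\<lambda>m::nat. ennreal ((1/16)^n))"
    proof (rule Liminf_mono)
      show "\<forall>\<^sub>F m in sequentially. (\<integral>\<^sup>+x. ennreal ((h m x - h n x)\<^sup>2) \<partial>M) \<le> ennreal ((1/16)^n)"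
        using eventually_ge_at_top[of n]
      proof eventually_elim
        case (elim m)
        then show ?case
          using sq_integrable_diff[OF h h, of m n] Cauchy[OF elim]
          by (subst nn_integral_eq_integral) (auto simp: sq_integrable_def ennreal_leI)
      qed
    qed
    finally show ?thesis by (simp add: Liminf_const)
  qed
  have diff: "sq_integrable M (\<lambda>x. h n x - k x)" for n
    unfolding sq_integrable_def
    using bound[of n] by (auto intro!: integrableI_bounded simp: le_less_trans[OF _ ennreal_less_top])
  have "sq_integrable M k"
    using sq_integrable_diff[OF h[of 0] diff[of 0]] by simp
  moreover have "(\<lambda>n. \<integral>x. (h n x - k x)\<^sup>2 \<partial>M) \<longlonglongrightarrow> 0"
  proof (rule Lim_null_comparison)
    have "(\<integral>x. (h n x - k x)\<^sup>2 \<partial>M) \<le> (1/16)^n" for n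
      using bound[of n] diff[of n]
      by (subst (asm) nn_integral_eq_integral) (auto simp: sq_integrable_def ennreal_le_iff)
    then show "\<forall>\<^sub>F n in sequentially. norm (\<integral>x. (h n x - k x)\<^sup>2 \<partial>M) \<le> (1/16)^n"
      by simp
    show "(\<lambda>n. (1/16::real)^n) \<longlonglongrightarrow> 0" by (rule LIMSEQ_realpow_zero) auto
  qed
  ultimately show thesis by (rule that)
qed

section \<open>Existence and uniqueness of vectors of minimal norm\<close>

lemma parallelogram_L2:
  assumes h: "sq_integrable M h" and k: "sq_integrable M k"
  shows "(\<integral>x. (h x - k x)\<^sup>2 \<partial>M)
    = 2 * (\<integral>x. (h x)\<^sup>2 \<partial>M) + 2 * (\<integral>x. (k x)\<^sup>2 \<partial>M) - 4 * (\<integral>x. ((h x + k x) / 2)\<^sup>2 \<partial>M)"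
proof -
  note ints = sq_integrable_integrable_square[OF h] sq_integrable_integrable_square[OF k]
    sq_integrable_integrable_square[OF sq_integrable_add[OF h k]]
  have "(\<integral>x. (h x - k x)\<^sup>2 \<partial>M) = (\<integral>x. 2 * (h x)\<^sup>2 + 2 * (k x)\<^sup>2 - (h x + k x)\<^sup>2 \<partial>M)"
    by (intro Bochner_Integration.integral_cong) (auto simp: power2_eq_square algebra_simps)
  also have "\<dots> = 2 * (\<integral>x. (h x)\<^sup>2 \<partial>M) + 2 * (\<integral>x. (k x)\<^sup>2 \<partial>M) - (\<integral>x. (h x + k x)\<^sup>2 \<partial>M)"
    using ints by simp
  finally show ?thesis by (simp add: power_divide)
qed

text \<open>The Hilbert space projection argument: midpoints stay in \<open>C\<close>, so by the
  parallelogram law two nearly minimal elements are close, and a minimising sequence converges to an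
  element of \<open>C\<close>.\<close>

lemma exists_min_norm_L2:
  fixes C :: "('a \<Rightarrow> real) set"
  assumes sq: "\<And>h. h \<in> C \<Longrightarrow> sq_integrable M h" and ne: "C \<noteq> {}"
    and mid: "\<And>h k. h \<in> C \<Longrightarrow> k \<in> C \<Longrightarrow> (\<lambda>x. (h x + k x) / 2) \<in> C"
    and closed: "\<And>h k. (\<And>n. h n \<in> C) \<Longrightarrow> sq_integrable M k
      \<Longrightarrow> (\<lambda>n. \<integral>x. (h n x - k x)\<^sup>2 \<partial>M) \<longlonglongrightarrow> 0 \<Longrightarrow> k \<in> C"
  shows "\<exists>k\<in>C. \<forall>h\<in>C. (\<integral>x. (k x)\<^sup>2 \<partial>M) \<le> (\<integral>x. (h x)\<^sup>2 \<partial>M)"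
proof -
  define a where "a = (INF h\<in>C. \<integral>x. (h x)\<^sup>2 \<partial>M)"
  have bdd: "bdd_below ((\<lambda>h. \<integral>x. (h x)\<^sup>2 \<partial>M) ` C)"
    by (rule bdd_belowI[of _ 0]) auto
  have a_le: "a \<le> (\<integral>x. (h x)\<^sup>2 \<partial>M)" if "h \<in> C" for h
    unfolding a_def by (rule cINF_lower[OF bdd that])
  \<comment> \<open>With this tolerance the parallelogram law bounds the squared distance of
    \<open>h m\<close> and \<open>h n\<close> by half the sum of \<open>(1/16)^m\<close> and
    \<open>(1/16)^n\<close>, which is at most \<open>(1/16)^n\<close> for \<open>n\<close> below
    \<open>m\<close>.\<close>
  have "\<exists>h\<in>C. (\<integral>x. (h x)\<^sup>2 \<partial>M) < a + (1/16)^n / 4" for n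
    unfolding a_def using cINF_less_iff[OF ne bdd, of "a + (1/16)^n / 4"] by (simp add: a_def)
  then obtain h where hC: "\<And>n. h n \<in> C"
    and h_less: "\<And>n. (\<integral>x. (h n x)\<^sup>2 \<partial>M) < a + (1/16)^n / 4" by metis
  have Cauchy: "(\<integral>x. (h m x - h n x)\<^sup>2 \<partial>M) \<le> (1/16)^n" if "n \<le> m" for n m
  proof -
    have "(1/16::real)^m \<le> (1/16)^n" using that by (intro power_decreasing) auto
    then show ?thesis
      using parallelogram_L2[OF sq sq, OF hC hC, of m n] a_le[OF mid, OF hC hC, of m n]
        h_less[of n] h_less[of m] by linarith
  qed
  obtain k where k: "sq_integrable M k" and lim: "(\<lambda>n. \<integral>x. (h n x - k x)\<^sup>2 \<partial>M) \<longlonglongrightarrow> 0"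
    by (rule rapidly_Cauchy_L2_complete[of M h, OF sq[OF hC] Cauchy])
  have kC: "k \<in> C" using closed[of h k, OF hC k lim] .
  have "(\<integral>x. (k x)\<^sup>2 \<partial>M) \<le> a"
  proof (rule LIMSEQ_le)
    \<comment> \<open>The left side is affine in \<open>h n\<close>, so its limit follows from
      convergence of inner products; the right side is at most the squared norm of
      \<open>h n\<close>.\<close>
    have eq: "2 * (\<integral>x. h n x * k x \<partial>M) - (\<integral>x. k x * k x \<partial>M)
      = (\<integral>x. (h n x)\<^sup>2 \<partial>M) - (\<integral>x. (h n x - k x)\<^sup>2 \<partial>M)" for n
    proof -
      note ints = sq_integrable_integrable_square[OF sq[OF hC[of n]]] sq_integrable_integrable_square[OF k]
        sq_integrable_integrable_mult[OF sq[OF hC[of n]] k]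
      have "(\<integral>x. (h n x - k x)\<^sup>2 \<partial>M) = (\<integral>x. (h n x)\<^sup>2 - 2 * (h n x * k x) + (k x)\<^sup>2 \<partial>M)"
        by (intro Bochner_Integration.integral_cong) (auto simp: power2_eq_square algebra_simps)
      also have "\<dots> = (\<integral>x. (h n x)\<^sup>2 \<partial>M) - 2 * (\<integral>x. h n x * k x \<partial>M) + (\<integral>x. (k x)\<^sup>2 \<partial>M)"
        using ints by simp
      finally show ?thesis by (simp add: power2_eq_square)
    qed
    have "(\<lambda>n. 2 * (\<integral>x. h n x * k x \<partial>M) - (\<integral>x. k x * k x \<partial>M))
        \<longlonglongrightarrow> 2 * (\<integral>x. k x * k x \<partial>M) - (\<integral>x. k x * k x \<partial>M)"
      by (intro tendsto_intros tendsto_integral_mult_L2 sq hC k lim)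
    then show "(\<lambda>n. (\<integral>x. (h n x)\<^sup>2 \<partial>M) - (\<integral>x. (h n x - k x)\<^sup>2 \<partial>M)) \<longlonglongrightarrow> (\<integral>x. (k x)\<^sup>2 \<partial>M)"
      unfolding eq by (simp add: power2_eq_square)
    have "(\<lambda>n. a + (1/16)^n / 4) \<longlonglongrightarrow> a + 0 / 4"
      by (intro tendsto_intros LIMSEQ_realpow_zero) auto
    then show "(\<lambda>n. a + (1/16)^n / 4) \<longlonglongrightarrow> a" by simp
    have "(\<integral>x. (h n x)\<^sup>2 \<partial>M) - (\<integral>x. (h n x - k x)\<^sup>2 \<partial>M) \<le> a + (1/16)^n / 4" for n
      using h_less[of n] Bochner_Integration.integral_nonneg[of M "\<lambda>x. (h n x - k x)\<^sup>2"]
      by (auto simp del: Bochner_Integration.integral_nonneg)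
    then show "\<exists>N. \<forall>n\<ge>N. (\<integral>x. (h n x)\<^sup>2 \<partial>M) - (\<integral>x. (h n x - k x)\<^sup>2 \<partial>M) \<le> a + (1/16)^n / 4"
      by blast
  qed
  then show ?thesis
    using kC a_le order_trans by blast
qed

text \<open>Strict convexity of the norm: when the midpoint is not shorter than the common length,
  the parallelogram law forces distance 0.\<close>

lemma min_norm_L2_unique:
  assumes h: "sq_integrable M h" and k: "sq_integrable M k"
    and eq: "(\<integral>x. (h x)\<^sup>2 \<partial>M) = (\<integral>x. (k x)\<^sup>2 \<partial>M)"
    and le: "(\<integral>x. (k x)\<^sup>2 \<partial>M) \<le> (\<integral>x. ((h x + k x) / 2)\<^sup>2 \<partial>M)"
  shows "AE x in M. h x = k x"
proof -
  have "(\<integral>x. (h x - k x)\<^sup>2 \<partial>M) \<le> 0"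
    using parallelogram_L2[OF h k] eq le by simp
  then have "(\<integral>x. (h x - k x)\<^sup>2 \<partial>M) = 0"
    by (rule order_antisym) simp
  then have "AE x in M. (h x - k x)\<^sup>2 = 0"
    using sq_integrable_integrable_square[OF sq_integrable_diff[OF h k]]
    by (subst (asm) integral_nonneg_eq_0_iff_AE) auto
  then show ?thesis by simp
qed

section \<open>The Koopman representation of a non-singular action\<close>

locale sigma_finite_nonsingular_action = sigma_finite_measure M
  for M :: "'s measure" +
  fixes \<phi> :: "'g::{topological_space, ab_group_add} \<Rightarrow> 's \<Rightarrow> 's"
  assumes action: "nonsingular_action M \<phi>"
begin

lemma action_measurable [measurable]: "\<phi> t \<in> measurable M M"
  using action by (simp add: nonsingular_action_def nonsingular_def)

lemma action_in_space: "s \<in> space M \<Longrightarrow> \<phi> t s \<in> space M"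
  by (rule measurable_space[OF action_measurable])

lemma action_add: "s \<in> space M \<Longrightarrow> \<phi> (u + v) s = \<phi> u (\<phi> v s)"
  using action by (simp add: nonsingular_action_def)

lemma action_zero [simp]: "s \<in> space M \<Longrightarrow> \<phi> 0 s = s"
  using action by (simp add: nonsingular_action_def)

lemma action_minus_cancel [simp]:
  assumes "s \<in> space M"
  shows "\<phi> (- t) (\<phi> t s) = s" "\<phi> t (\<phi> (- t) s) = s"
  using assms action_add[of s "- t" t] action_add[of s t "- t"] by simp_all

lemma inv_into_action: "s \<in> space M \<Longrightarrow> inv_into (space M) (\<phi> t) s = \<phi> (- t) s"
  by (intro inv_into_f_eq inj_onI) (metis action_in_space action_minus_cancel)+

lemma absolutely_continuous_distr_action: "absolutely_continuous M (distr M M (\<phi> t))"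
  using action by (auto simp: nonsingular_action_def nonsingular_def absolutely_continuous_def null_sets_def)

lemma AE_action: "AE s in M. Q s \<Longrightarrow> AE s in M. Q (\<phi> t s)"
  using absolutely_continuous_AE[OF _ absolutely_continuous_distr_action]
  by (intro AE_distrD[OF action_measurable]) simp

section \<open>The Radon-Nikodym cocycle of the action\<close>

definition cocycle :: "'g \<Rightarrow> 's \<Rightarrow> real" where
  "cocycle t s = enn2real (RN_deriv M (distr M M (\<phi> t)) s)"

lemma cocycle_measurable [measurable]: "cocycle t \<in> borel_measurable M"
  unfolding cocycle_def by measurable

lemma cocycle_nonneg [simp]: "0 \<le> cocycle t s"
  by (simp add: cocycle_def)

text \<open>Replacing an infinite derivative by 0 changes it only on a null set. Sigma-finiteness
  supplies an integrable \<open>w > 0\<close>; the derivative times \<open>w\<close> composed with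
  \<open>\<phi> (- t)\<close> has the same finite integral as \<open>w\<close>, hence is finite
  almost everywhere.\<close>

lemma RN_deriv_action: "AE s in M. RN_deriv M (distr M M (\<phi> t)) s = ennreal (cocycle t s)"
proof -
  let ?R = "RN_deriv M (distr M M (\<phi> t))"
  obtain w where w [measurable]: "w \<in> borel_measurable M"
    and fin: "(\<integral>\<^sup>+s. w s \<partial>M) \<noteq> \<infinity>" and pos: "\<And>s. s \<in> space M \<Longrightarrow> 0 < w s \<and> w s < \<infinity>"
    using Ex_finite_integrable_function by auto
  have "(\<integral>\<^sup>+s. ?R s * w (\<phi> (- t) s) \<partial>M) = (\<integral>\<^sup>+s. w (\<phi> (- t) s) \<partial>distr M M (\<phi> t))"
    by (intro RN_deriv_nn_integral[symmetric] absolutely_continuous_distr_action) auto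
  also have "\<dots> = (\<integral>\<^sup>+s. w (\<phi> (- t) (\<phi> t s)) \<partial>M)"
    by (intro nn_integral_distr) auto
  also have "\<dots> = (\<integral>\<^sup>+s. w s \<partial>M)"
    by (intro nn_integral_cong) simp
  finally have "AE s in M. ?R s * w (\<phi> (- t) s) \<noteq> \<infinity>"
    using fin by (intro nn_integral_PInf_AE) auto
  then show ?thesis
    using AE_space
  proof eventually_elim
    case (elim s)
    then have "?R s \<noteq> \<infinity>"
      using pos[OF action_in_space[OF elim(2)], of "- t"] by (auto simp: ennreal_top_mult split: if_splits)
    then show ?case by (simp add: cocycle_def less_top)
  qed
qed

lemma distr_action: "distr M M (\<phi> t) = density M (\<lambda>s. ennreal (cocycle t s))"
proof -
  have "distr M M (\<phi> t) = density M (RN_deriv M (distr M M (\<phi> t)))"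
    by (intro density_RN_deriv[symmetric] absolutely_continuous_distr_action) simp
  also have "\<dots> = density M (\<lambda>s. ennreal (cocycle t s))"
    by (intro density_cong RN_deriv_action) auto
  finally show ?thesis .
qed

lemma nn_integral_cocycle:
  assumes [measurable]: "w \<in> borel_measurable M"
  shows "(\<integral>\<^sup>+s. ennreal (cocycle t s) * w s \<partial>M) = (\<integral>\<^sup>+s. w (\<phi> t s) \<partial>M)"
proof -
  have "(\<integral>\<^sup>+s. ennreal (cocycle t s) * w s \<partial>M) = (\<integral>\<^sup>+s. w s \<partial>distr M M (\<phi> t))"
    unfolding distr_action by (intro nn_integral_density[symmetric]) auto
  also have "\<dots> = (\<integral>\<^sup>+s. w (\<phi> t s) \<partial>M)"
    by (intro nn_integral_distr) auto
  finally show ?thesis .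
qed

text \<open>The dual operator is the push-forward read on densities; writing \<open>w s\<close> as
  \<open>w (\<phi> (- t) (\<phi> t s))\<close> makes the integrand a function of
  \<open>\<phi> t s\<close>.\<close>

lemma distr_density_action:
  assumes [measurable]: "w \<in> borel_measurable M"
  shows "distr (density M w) M (\<phi> t) = density M (\<lambda>s. ennreal (cocycle t s) * w (\<phi> (- t) s))"
proof (rule measure_eqI)
  fix A assume "A \<in> sets (distr (density M w) M (\<phi> t))"
  then have A [measurable]: "A \<in> sets M" by simp
  have "emeasure (distr (density M w) M (\<phi> t)) A = emeasure (density M w) (\<phi> t -` A \<inter> space M)"
    by (subst emeasure_distr) auto
  also have "\<dots> = (\<integral>\<^sup>+s. w s * indicator (\<phi> t -` A \<inter> space M) s \<partial>M)"
    by (intro emeasure_density) auto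
  also have "\<dots> = (\<integral>\<^sup>+s. w (\<phi> (- t) (\<phi> t s)) * indicator A (\<phi> t s) \<partial>M)"
    by (intro nn_integral_cong) (auto simp: indicator_def)
  also have "\<dots> = (\<integral>\<^sup>+s. ennreal (cocycle t s) * (w (\<phi> (- t) s) * indicator A s) \<partial>M)"
    by (rule nn_integral_cocycle[symmetric]) measurable
  also have "\<dots> = (\<integral>\<^sup>+s. ennreal (cocycle t s) * w (\<phi> (- t) s) * indicator A s \<partial>M)"
    by (simp add: mult.assoc)
  also have "\<dots> = emeasure (density M (\<lambda>s. ennreal (cocycle t s) * w (\<phi> (- t) s))) A"
    by (rule emeasure_density[symmetric]) measurable
  finally show "emeasure (distr (density M w) M (\<phi> t)) A
    = emeasure (density M (\<lambda>s. ennreal (cocycle t s) * w (\<phi> (- t) s))) A" .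
qed simp

lemma invariant_density_iff:
  assumes [measurable]: "w \<in> borel_measurable M"
  shows "distr (density M w) M (\<phi> t) = density M w
    \<longleftrightarrow> (AE s in M. ennreal (cocycle t s) * w (\<phi> (- t) s) = w s)"
  unfolding distr_density_action[OF assms] by (rule density_unique_iff) measurable

text \<open>The chain rule: push \<open>M\<close> forward by \<open>\<phi> v\<close>, then by
  \<open>\<phi> u\<close>, and compare densities. The exceptional null set may depend on
  \<open>u\<close> and \<open>v\<close>.\<close>

lemma cocycle_add: "AE s in M. cocycle (u + v) s = cocycle u s * cocycle v (\<phi> (- u) s)"
proof -
  have "density M (\<lambda>s. ennreal (cocycle (u + v) s)) = distr M M (\<phi> (u + v))"
    by (rule distr_action[symmetric])
  also have "\<dots> = distr M M (\<phi> u \<circ> \<phi> v)"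
    by (intro distr_cong) (auto simp: action_add)
  also have "\<dots> = distr (distr M M (\<phi> v)) M (\<phi> u)"
    by (intro distr_distr[symmetric]) auto
  also have "\<dots> = density M (\<lambda>s. ennreal (cocycle u s) * ennreal (cocycle v (\<phi> (- u) s)))"
    unfolding distr_action[of v] by (rule distr_density_action) measurable
  finally have "AE s in M. ennreal (cocycle (u + v) s) = ennreal (cocycle u s) * ennreal (cocycle v (\<phi> (- u) s))"
    by (subst (asm) density_unique_iff) measurable
  then show ?thesis
    by eventually_elim (simp add: ennreal_mult[symmetric])
qed

section \<open>Koopman operators on L2 and their fixed vectors\<close>

definition koopman :: "'g \<Rightarrow> ('s \<Rightarrow> real) \<Rightarrow> 's \<Rightarrow> real" where
  "koopman t h s = sqrt (cocycle t s) * h (\<phi> (- t) s)"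

lemma koopman_measurable [measurable]:
  assumes [measurable]: "h \<in> borel_measurable M"
  shows "koopman t h \<in> borel_measurable M"
  unfolding koopman_def by measurable

lemma koopman_add: "AE s in M. koopman (u + v) h s = koopman u (koopman v h) s"
  using cocycle_add[of u v] AE_space
proof eventually_elim
  case (elim s)
  have "\<phi> (- (u + v)) s = \<phi> (- v) (\<phi> (- u) s)"
    using elim action_add[of s "- v" "- u"] by (metis add.commute minus_add_distrib)
  then show ?case
    using elim by (simp add: koopman_def real_sqrt_mult)
qed

text \<open>The two square roots multiply to the cocycle, which is the Jacobian of the substitution
  by \<open>\<phi> t\<close>.\<close>

lemma koopman_unitary:
  assumes [measurable]: "h \<in> borel_measurable M" "k \<in> borel_measurable M"
  shows "integrable M (\<lambda>s. koopman t h s * koopman t k s) \<longleftrightarrow> integrable M (\<lambda>s. h s * k s)"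
    and "(\<integral>s. koopman t h s * koopman t k s \<partial>M) = (\<integral>s. h s * k s \<partial>M)"
proof -
  let ?F = "\<lambda>s. h (\<phi> (- t) s) * k (\<phi> (- t) s)"
  have eq: "koopman t h s * koopman t k s = cocycle t s *\<^sub>R ?F s" for s
  proof -
    have "koopman t h s * koopman t k s = (sqrt (cocycle t s) * sqrt (cocycle t s)) * ?F s"
      unfolding koopman_def by (simp only: mult_ac)
    then show ?thesis by simp
  qed
  have "integrable M (\<lambda>s. cocycle t s *\<^sub>R ?F s) \<longleftrightarrow> integrable (distr M M (\<phi> t)) ?F"
    unfolding distr_action by (rule integrable_density[symmetric]) auto
  also have "\<dots> \<longleftrightarrow> integrable M (\<lambda>s. ?F (\<phi> t s))"
    by (rule integrable_distr_eq) auto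
  also have "\<dots> \<longleftrightarrow> integrable M (\<lambda>s. h s * k s)"
    by (intro Bochner_Integration.integrable_cong) auto
  finally show "integrable M (\<lambda>s. koopman t h s * koopman t k s) \<longleftrightarrow> integrable M (\<lambda>s. h s * k s)"
    unfolding eq .
  have "(\<integral>s. cocycle t s *\<^sub>R ?F s \<partial>M) = (\<integral>s. ?F s \<partial>distr M M (\<phi> t))"
    unfolding distr_action by (rule integral_density[symmetric]) auto
  also have "\<dots> = (\<integral>s. ?F (\<phi> t s) \<partial>M)"
    by (rule integral_distr) auto
  also have "\<dots> = (\<integral>s. h s * k s \<partial>M)"
    by (intro Bochner_Integration.integral_cong) auto
  finally show "(\<integral>s. koopman t h s * koopman t k s \<partial>M) = (\<integral>s. h s * k s \<partial>M)"
    unfolding eq .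
qed

lemma sq_integrable_koopman:
  assumes "sq_integrable M h"
  shows "sq_integrable M (koopman t h)"
proof -
  have [measurable]: "h \<in> borel_measurable M" using assms by (simp add: sq_integrable_def)
  show ?thesis
    using assms koopman_unitary(1)[of h h t] by (simp add: sq_integrable_def power2_eq_square)
qed

text \<open>The lower bound on the inner product serves to keep \<open>h\<close> away from zero on
  the support of \<open>g\<close>. It is phrased with \<open>koopman 0 g\<close> because it is the
  instance \<open>t = 0\<close> of the constraints defining \<open>C\<close>.\<close>

lemma exists_invariant_density:
  assumes g: "sq_integrable M g" and c: "\<And>t. c \<le> (\<integral>s. g s * koopman t g s \<partial>M)"
  obtains h where "sq_integrable M h" "c \<le> (\<integral>s. h s * koopman 0 g s \<partial>M)"
    "density M (\<lambda>s. ennreal ((h s)\<^sup>2)) \<in> Lambda_inv M \<phi>"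
proof -
  have [measurable]: "g \<in> borel_measurable M" using g by (simp add: sq_integrable_def)
  define C where "C = {h. sq_integrable M h \<and> (\<forall>t. c \<le> (\<integral>s. h s * koopman t g s \<partial>M))}"
  have sqC: "sq_integrable M h" if "h \<in> C" for h using that by (simp add: C_def)
  note Ug = sq_integrable_koopman[OF g]
  have mid: "(\<lambda>x. (h x + k x) / 2) \<in> C" if h: "h \<in> C" and k: "k \<in> C" for h k
  proof -
    have "sq_integrable M (\<lambda>x. (h x + k x) / 2)"
      using sq_integrable_cmult[OF sq_integrable_add[OF sqC[OF h] sqC[OF k]], of "1/2"] by simp
    moreover have "c \<le> (\<integral>s. (h s + k s) / 2 * koopman t g s \<partial>M)" for t
    proof -
      have "(\<integral>s. (h s + k s) / 2 * koopman t g s \<partial>M)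
          = (\<integral>s. (1/2) * (h s * koopman t g s) + (1/2) * (k s * koopman t g s) \<partial>M)"
        by (intro Bochner_Integration.integral_cong) (auto simp: field_simps)
      also have "\<dots> = (1/2) * (\<integral>s. h s * koopman t g s \<partial>M) + (1/2) * (\<integral>s. k s * koopman t g s \<partial>M)"
        using sq_integrable_integrable_mult[OF sqC[OF h] Ug[of t]]
          sq_integrable_integrable_mult[OF sqC[OF k] Ug[of t]]
        by (subst Bochner_Integration.integral_add) auto
      moreover have "c \<le> (\<integral>s. h s * koopman t g s \<partial>M)" "c \<le> (\<integral>s. k s * koopman t g s \<partial>M)"
        using h k by (auto simp: C_def)
      ultimately show ?thesis by linarith
    qed
    ultimately show ?thesis by (simp add: C_def)
  qed
  have closed: "k \<in> C" if h: "\<And>n. h n \<in> C" and k: "sq_integrable M k"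
    and lim: "(\<lambda>n. \<integral>x. (h n x - k x)\<^sup>2 \<partial>M) \<longlonglongrightarrow> 0" for h k
  proof -
    have "c \<le> (\<integral>s. k s * koopman t g s \<partial>M)" for t
    proof (rule LIMSEQ_le_const)
      show "(\<lambda>n. \<integral>s. h n s * koopman t g s \<partial>M) \<longlonglongrightarrow> (\<integral>s. k s * koopman t g s \<partial>M)"
        by (rule tendsto_integral_mult_L2[of M h k "koopman t g", OF sqC[OF h] k Ug lim])
      show "\<exists>N. \<forall>n\<ge>N. c \<le> (\<integral>s. h n s * koopman t g s \<partial>M)"
        using h by (auto simp: C_def)
    qed
    then show ?thesis using k by (simp add: C_def)
  qed
  have "g \<in> C" using g c by (simp add: C_def)
  then have "C \<noteq> {}" by blast
  have "\<exists>h\<in>C. \<forall>k\<in>C. (\<integral>s. (h s)\<^sup>2 \<partial>M) \<le> (\<integral>s. (k s)\<^sup>2 \<partial>M)"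
    using sqC \<open>C \<noteq> {}\<close> mid closed by (rule exists_min_norm_L2)
  then obtain h where h: "h \<in> C"
    and min: "\<And>k. k \<in> C \<Longrightarrow> (\<integral>s. (h s)\<^sup>2 \<partial>M) \<le> (\<integral>s. (k s)\<^sup>2 \<partial>M)"
    by auto
  note sqh = sqC[OF h]
  have [measurable]: "h \<in> borel_measurable M" using sqh by (simp add: sq_integrable_def)
  \<comment> \<open>\<open>koopman t h\<close> lies in \<open>C\<close> and has the same norm as the
    minimiser \<open>h\<close>, so uniqueness applies. The null set may depend on \<open>t\<close>,
    since invariance is asserted for each \<open>t\<close> separately.\<close>
  have fixed: "AE s in M. koopman t h s = h s" for t
  proof (rule min_norm_L2_unique)
    show "sq_integrable M (koopman t h)" by (rule sq_integrable_koopman[OF sqh])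
    show "sq_integrable M h" by (rule sqh)
    show "(\<integral>s. (koopman t h s)\<^sup>2 \<partial>M) = (\<integral>s. (h s)\<^sup>2 \<partial>M)"
      using koopman_unitary(2)[of h h t] by (simp add: power2_eq_square)
    \<comment> \<open>Splitting \<open>u\<close> as \<open>t + (u - t)\<close> and cancelling the
      unitary \<open>koopman t\<close> reduces the constraint at \<open>u\<close> for
      \<open>koopman t h\<close> to the one at \<open>u - t\<close> for \<open>h\<close>.\<close>
    have "c \<le> (\<integral>s. koopman t h s * koopman u g s \<partial>M)" for u
    proof -
      have "(\<integral>s. koopman t h s * koopman u g s \<partial>M)
          = (\<integral>s. koopman t h s * koopman t (koopman (u - t) g) s \<partial>M)"
        using koopman_add[of t "u - t" g] by (intro integral_cong_AE) auto
      also have "\<dots> = (\<integral>s. h s * koopman (u - t) g s \<partial>M)"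
        by (rule koopman_unitary(2)) measurable
      finally show ?thesis using h by (simp add: C_def)
    qed
    then have "koopman t h \<in> C"
      using sq_integrable_koopman[OF sqh] by (simp add: C_def)
    then show "(\<integral>s. (h s)\<^sup>2 \<partial>M) \<le> (\<integral>s. ((koopman t h s + h s) / 2)\<^sup>2 \<partial>M)"
      by (intro min mid h)
  qed
  have inv: "distr (density M (\<lambda>s. ennreal ((h s)\<^sup>2))) M (\<phi> t) = density M (\<lambda>s. ennreal ((h s)\<^sup>2))" for t
  proof (subst invariant_density_iff)
    show "AE s in M. ennreal (cocycle t s) * ennreal ((h (\<phi> (- t) s))\<^sup>2) = ennreal ((h s)\<^sup>2)"
      using fixed[of t]
    proof eventually_elim
      case (elim s)
      have "cocycle t s * (h (\<phi> (- t) s))\<^sup>2 = (koopman t h s)\<^sup>2"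
        by (simp add: koopman_def power_mult_distrib)
      then show ?case using elim by (simp add: ennreal_mult[symmetric])
    qed
  qed measurable
  have "density M (\<lambda>s. ennreal ((h s)\<^sup>2)) \<in> Lambda_inv M \<phi>"
    unfolding Lambda_inv_def
  proof (intro CollectI conjI allI inv)
    show "finite_measure (density M (\<lambda>s. ennreal ((h s)\<^sup>2)))"
      using sq_integrable_integrable_square[OF sqh]
      by (intro finite_measureI) (simp add: emeasure_density nn_integral_eq_integral cong: nn_integral_cong)
    show "absolutely_continuous M (density M (\<lambda>s. ennreal ((h s)\<^sup>2)))"
      by (intro absolutely_continuousI_density) measurable
  qed simp
  then show thesis
    using that[OF sqh] h by (simp add: C_def)
qed

subsection \<open>Divergence and convergence of series of dual operators\<close>

text \<open>Countability of the index set yields one null set for all \<open>n\<close>, so the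
  series can afterwards be studied pointwise.\<close>

lemma dual_op_action:
  assumes "\<And>s. s \<in> space M \<Longrightarrow> 0 \<le> f s"
  shows "AE s in M. \<forall>n::nat. dual_op M (\<phi> (u n)) f s = ennreal (cocycle (u n) s * f (\<phi> (- u n) s))"
proof -
  have "AE s in M. dual_op M (\<phi> (u n)) f s = ennreal (cocycle (u n) s * f (\<phi> (- u n) s))" for n
    using RN_deriv_action[of "u n"] AE_space
  proof eventually_elim
    case (elim s)
    then show ?case
      using assms[OF action_in_space[OF elim(2)], of "- u n"]
      by (simp add: dual_op_def inv_into_action ennreal_mult)
  qed
  then show ?thesis by (simp add: AE_all_countable)
qed

text \<open>The density equation shows that positivity at \<open>s\<close> passes to
  \<open>\<phi> (- t) s\<close>; using it for both \<open>t\<close> and \<open>- t\<close> gives the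
  equivalence.\<close>

lemma invariant_support:
  assumes h [measurable]: "h \<in> borel_measurable M" and inv: "density M h \<in> Lambda_inv M \<phi>"
  shows "AE s in M. 0 < h (\<phi> t s) \<longleftrightarrow> 0 < h s"
proof -
  have *: "AE s in M. 0 < h s \<longrightarrow> 0 < h (\<phi> (- t) s)" for t
  proof -
    have "AE s in M. ennreal (cocycle t s) * h (\<phi> (- t) s) = h s"
      using inv invariant_density_iff[OF h, of t] by (simp add: Lambda_inv_def)
    then show ?thesis
      by eventually_elim (auto simp: zero_less_iff_neq_zero)
  qed
  have "AE s in M. 0 < h (\<phi> t s) \<longrightarrow> 0 < h (\<phi> (- t) (\<phi> t s))"
    by (rule AE_action[OF *])
  with *[of "- t"] AE_space show ?thesis
    by eventually_elim auto
qed

text \<open>Of convergence only the vanishing of the terms is exploited, which is why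
  \<open>u\<close> can be arbitrary.\<close>

lemma AE_suminf_dual_op_eq_top:
  assumes h [measurable]: "h \<in> borel_measurable M" and inv: "density M h \<in> Lambda_inv M \<phi>"
    and f [measurable]: "f \<in> borel_measurable M" and f_pos: "\<And>s. s \<in> space M \<Longrightarrow> 0 < f s"
  shows "AE s in M. 0 < h s \<longrightarrow> (\<Sum>n. dual_op M (\<phi> (u n)) f s) = \<infinity>"
proof -
  define \<nu> where "\<nu> = density M h"
  interpret \<nu>: finite_measure \<nu> using inv by (simp add: Lambda_inv_def \<nu>_def)
  have sets_\<nu> [measurable_cong, simp]: "sets \<nu> = sets M" and space_\<nu> [simp]: "space \<nu> = space M"
    by (simp_all add: \<nu>_def)
  have inv_\<nu>: "distr \<nu> M (\<phi> t) = \<nu>" for t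
    using inv by (simp add: Lambda_inv_def \<nu>_def)
  define r where "r s = enn2real (h s)" for s
  have [measurable]: "r \<in> borel_measurable M" unfolding r_def by measurable
  have "(\<integral>\<^sup>+s. h s \<partial>M) = emeasure \<nu> (space M)"
    unfolding \<nu>_def by (subst emeasure_density) (auto intro!: nn_integral_cong)
  then have "(\<integral>\<^sup>+s. h s \<partial>M) \<noteq> \<infinity>"
    using \<nu>.emeasure_finite[of "space M"] by simp
  then have h_fin: "AE s in M. h s = ennreal (r s)"
    using nn_integral_PInf_AE[OF h] unfolding r_def by (auto elim!: eventually_mono simp: less_top)
  have h_inv: "AE s in M. \<forall>n. cocycle (u n) s * r (\<phi> (- u n) s) = r s"
    unfolding AE_all_countable
  proof
    fix n
    have "AE s in M. ennreal (cocycle (u n) s) * h (\<phi> (- u n) s) = h s"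
      using inv_\<nu> invariant_density_iff[OF h] by (simp add: \<nu>_def)
    then show "AE s in M. cocycle (u n) s * r (\<phi> (- u n) s) = r s"
      by eventually_elim (metis cocycle_nonneg enn2real_ennreal enn2real_mult r_def)
  qed
  \<comment> \<open>This is the set where \<open>f / r < 1 / (k + 1)\<close>, cross-multiplied so
    that no division by \<open>r = 0\<close> occurs.\<close>
  define B where "B k = {s \<in> space M. f s * real (Suc k) < r s}" for k
  have B [measurable]: "B k \<in> sets M" for k unfolding B_def by measurable
  define F where "F s = (\<Sum>n. ennreal (cocycle (u n) s * f (\<phi> (- u n) s)))" for s
  have [measurable]: "F \<in> borel_measurable M" unfolding F_def by measurable
  define D where "D = {s \<in> space M. F s \<noteq> \<infinity>}"
  have D [measurable]: "D \<in> sets M" unfolding D_def by measurable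
  have D_le: "emeasure \<nu> D \<le> emeasure \<nu> (B k)" for k
  proof -
    \<comment> \<open>Points whose translates by \<open>\<phi> (- u n)\<close> stay in
      \<open>B k\<close> from index \<open>N\<close> on; almost every point of \<open>D\<close> with
      \<open>h > 0\<close> lies in some \<open>E N\<close>.\<close>
    define E where "E N = {s \<in> space M. \<forall>n\<ge>N. \<phi> (- u n) s \<in> B k}" for N
    have [measurable]: "E N \<in> sets M" for N unfolding E_def by measurable
    have "AE s in M. 0 < h s \<longrightarrow> s \<in> D \<longrightarrow> s \<in> (\<Union>N. E N)"
      using h_inv h_fin
    proof (eventually_elim, intro impI)
      fix s assume inv_s: "\<forall>n. cocycle (u n) s * r (\<phi> (- u n) s) = r s" and "h s = ennreal (r s)"
        and "0 < h s" and s: "s \<in> D"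
      then have "0 < r s" by simp
      have sM: "s \<in> space M" using s by (simp add: D_def)
      have nonneg: "0 \<le> cocycle (u n) s * f (\<phi> (- u n) s)" for n
        using f_pos[OF action_in_space[OF sM]] by (simp add: less_imp_le)
      have "summable (\<lambda>n. cocycle (u n) s * f (\<phi> (- u n) s))"
        using s nonneg by (intro summable_suminf_not_top) (auto simp: D_def F_def)
      then have "(\<lambda>n. cocycle (u n) s * f (\<phi> (- u n) s)) \<longlonglongrightarrow> 0"
        by (rule summable_LIMSEQ_zero)
      then have "\<forall>\<^sub>F n in sequentially. cocycle (u n) s * f (\<phi> (- u n) s) < r s / real (Suc k)"
        using \<open>0 < r s\<close> by (intro order_tendstoD(2)) auto
      then obtain N where N: "cocycle (u n) s * f (\<phi> (- u n) s) < r s / real (Suc k)" if "n \<ge> N" for n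
        unfolding eventually_sequentially by blast
      have "\<phi> (- u n) s \<in> B k" if "n \<ge> N" for n
      proof -
        \<comment> \<open>By invariance \<open>r s\<close> equals the right side, so the cocycle
          factor cancels from the bound on the terms.\<close>
        have "cocycle (u n) s * (f (\<phi> (- u n) s) * real (Suc k)) < cocycle (u n) s * r (\<phi> (- u n) s)"
          using N[OF that] inv_s by (simp add: field_simps)
        then have "f (\<phi> (- u n) s) * real (Suc k) < r (\<phi> (- u n) s)"
          by (rule mult_left_less_imp_less) simp
        then show ?thesis using action_in_space[OF sM] by (simp add: B_def)
      qed
      then show "s \<in> (\<Union>N. E N)" using sM by (auto simp: E_def)
    qed
    then have "AE s in \<nu>. s \<in> D \<longrightarrow> s \<in> (\<Union>N. E N)"
      unfolding \<nu>_def AE_density[OF h] .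
    then have "emeasure \<nu> D \<le> emeasure \<nu> (\<Union>N. E N)"
      by (intro emeasure_mono_AE) auto
    also have "\<dots> = (SUP N. emeasure \<nu> (E N))"
      by (intro SUP_emeasure_incseq[symmetric]) (auto simp: incseq_def E_def)
    \<comment> \<open>\<open>E N\<close> lies in the single preimage belonging to
      \<open>n = N\<close>, whose measure is that of \<open>B k\<close> by invariance.\<close>
    also have "\<dots> \<le> emeasure \<nu> (B k)"
    proof (rule SUP_least)
      fix N
      have "emeasure \<nu> (E N) \<le> emeasure \<nu> (\<phi> (- u N) -` B k \<inter> space \<nu>)"
        by (intro emeasure_mono) (auto simp: E_def)
      also have "\<dots> = emeasure (distr \<nu> M (\<phi> (- u N))) (B k)"
        by (intro emeasure_distr[symmetric]) measurable
      finally show "emeasure \<nu> (E N) \<le> emeasure \<nu> (B k)" by (simp add: inv_\<nu>)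
    qed
    finally show ?thesis .
  qed
  \<comment> \<open>As \<open>f > 0\<close> and \<open>r\<close> is real-valued, the decreasing sets
    \<open>B k\<close> have empty intersection, and finiteness of \<open>\<nu>\<close> gives
    continuity from above.\<close>
  have "(\<Inter>k. B k) = {}"
  proof (rule equals0I)
    fix s assume s: "s \<in> (\<Inter>k. B k)"
    then have "0 < f s" using f_pos by (auto simp: B_def)
    then obtain k where "r s < real k * f s" using reals_Archimedean3 by blast
    also have "\<dots> \<le> f s * real (Suc k)" using \<open>0 < f s\<close> by (simp add: algebra_simps)
    finally show False using s by (auto simp: B_def not_less dest: spec[of _ k] less_asym)
  qed
  moreover have "decseq B"
  proof (rule decseq_SucI)
    fix k show "B (Suc k) \<subseteq> B k"
    proof
      fix s assume "s \<in> B (Suc k)"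
      then have "s \<in> space M" and lt: "f s * real (Suc (Suc k)) < r s" by (auto simp: B_def)
      then have "f s * real (Suc k) \<le> f s * real (Suc (Suc k))"
        using f_pos[of s] by (intro mult_left_mono) auto
      then show "s \<in> B k" using lt \<open>s \<in> space M\<close> by (simp add: B_def)
    qed
  qed
  ultimately have "(\<lambda>k. emeasure \<nu> (B k)) \<longlonglongrightarrow> 0"
    using Lim_emeasure_decseq[of B \<nu>] by (auto simp: image_subset_iff)
  then have "emeasure \<nu> D \<le> 0"
    using D_le by (intro LIMSEQ_le_const) auto
  then have "AE s in \<nu>. s \<notin> D"
    by (intro AE_not_in) (auto simp: null_sets_def)
  then have "AE s in M. 0 < h s \<longrightarrow> s \<notin> D"
    unfolding \<nu>_def AE_density[OF h] .
  moreover have "AE s in M. \<forall>n. dual_op M (\<phi> (u n)) f s = ennreal (cocycle (u n) s * f (\<phi> (- u n) s))"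
    using f_pos by (intro dual_op_action) (simp add: less_imp_le)
  ultimately show ?thesis
    using AE_space by eventually_elim (simp add: D_def F_def)
qed

lemma exists_sequence_suminf_dual_op_less_top:
  assumes P: "positive_part M \<phi> P"
    and Ninv: "\<And>t. AE s in M. s \<notin> P \<longrightarrow> \<phi> t s \<notin> P" and [measurable]: "P \<in> sets M"
    and f: "integrable M f" and f_pos: "\<And>s. s \<in> space M \<Longrightarrow> 0 < f s"
  obtains u :: "nat \<Rightarrow> 'g" where "AE s in M. s \<notin> P \<longrightarrow> (\<Sum>n. dual_op M (\<phi> (u n)) f s) < \<infinity>"
proof -
  have [measurable]: "f \<in> borel_measurable M" using f by auto
  define g where "g s = (if s \<in> P then 0 else sqrt (f s))" for s
  have g_meas [measurable]: "g \<in> borel_measurable M" unfolding g_def by measurable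
  have g_nonneg: "0 \<le> g s" if "s \<in> space M" for s
    using f_pos[OF that] by (simp add: g_def)
  have "integrable M (\<lambda>s. (g s)\<^sup>2)"
    using f_pos by (intro Bochner_Integration.integrable_bound[OF f]) (auto simp: g_def less_imp_le)
  then have g: "sq_integrable M g" by (simp add: sq_integrable_def)
  \<comment> \<open>Otherwise there is an invariant density \<open>h^2\<close>. By maximality of
    \<open>P\<close> its support lies in \<open>P\<close> up to a null set, where \<open>g\<close>,
    hence \<open>koopman 0 g\<close>, vanishes; the inner product would be 0, not at least
    \<open>c\<close>.\<close>
  have "\<exists>t. (\<integral>s. g s * koopman t g s \<partial>M) < c" if "0 < c" for c
  proof (rule ccontr)
    assume "\<not> ?thesis"
    then have "\<And>t. c \<le> (\<integral>s. g s * koopman t g s \<partial>M)" by (simp add: not_less)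
    then obtain h where h: "sq_integrable M h" and c_le: "c \<le> (\<integral>s. h s * koopman 0 g s \<partial>M)"
      and inv: "density M (\<lambda>s. ennreal ((h s)\<^sup>2)) \<in> Lambda_inv M \<phi>"
      by (rule exists_invariant_density[OF g])
    have [measurable]: "h \<in> borel_measurable M" using h by (simp add: sq_integrable_def)
    have "{s \<in> space M. 0 < ennreal ((h s)\<^sup>2)} \<in> I_inv M \<phi>"
      unfolding I_inv_def using inv by (intro CollectI exI conjI refl) auto
    then have "emeasure M ({s \<in> space M. 0 < ennreal ((h s)\<^sup>2)} - P) = 0"
      using P by (simp add: positive_part_def)
    then have "AE s in M. s \<notin> {s \<in> space M. 0 < ennreal ((h s)\<^sup>2)} - P"
      by (intro AE_not_in) (auto simp: null_sets_def)
    then have "AE s in M. h s * koopman 0 g s = 0"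
      using AE_space by eventually_elim (auto simp: koopman_def g_def)
    then have "(\<integral>s. h s * koopman 0 g s \<partial>M) = 0"
      by (rule integral_eq_zero_AE)
    then show False using c_le \<open>0 < c\<close> by simp
  qed
  then have "\<exists>t. (\<integral>s. g s * koopman t g s \<partial>M) < (1/2)^n" for n :: nat by simp
  then obtain u where u: "\<And>n. (\<integral>s. g s * koopman (u n) g s \<partial>M) < (1/2)^n" by metis
  have prod_nonneg: "0 \<le> g s * koopman (u n) g s" if "s \<in> space M" for s n
    using g_nonneg[OF that] g_nonneg[OF action_in_space[OF that]] by (simp add: koopman_def)
  have "(\<integral>\<^sup>+s. (\<Sum>n. ennreal (g s * koopman (u n) g s)) \<partial>M)
      = (\<Sum>n. \<integral>\<^sup>+s. ennreal (g s * koopman (u n) g s) \<partial>M)"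
    by (intro nn_integral_suminf) measurable
  also have "\<dots> \<le> (\<Sum>n. ennreal ((1/2)^n))"
  proof (intro suminf_le)
    fix n
    show "(\<integral>\<^sup>+s. ennreal (g s * koopman (u n) g s) \<partial>M) \<le> ennreal ((1/2)^n)"
      using u[of n] sq_integrable_integrable_mult[OF g sq_integrable_koopman[OF g]] prod_nonneg
      by (subst nn_integral_eq_integral) (auto intro: ennreal_leI)
  qed auto
  also have "\<dots> < \<infinity>"
    by (subst suminf_ennreal2) (auto intro!: summable_geometric)
  finally have "AE s in M. (\<Sum>n. ennreal (g s * koopman (u n) g s)) \<noteq> \<infinity>"
    by (intro nn_integral_PInf_AE) auto
  moreover have "AE s in M. \<forall>n. s \<notin> P \<longrightarrow> \<phi> (- u n) s \<notin> P"
    unfolding AE_all_countable using Ninv by blast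
  moreover have "AE s in M. \<forall>n. dual_op M (\<phi> (u n)) f s = ennreal (cocycle (u n) s * f (\<phi> (- u n) s))"
    using f_pos by (intro dual_op_action) (simp add: less_imp_le)
  ultimately have "AE s in M. s \<notin> P \<longrightarrow> (\<Sum>n. dual_op M (\<phi> (u n)) f s) < \<infinity>"
    using AE_space
  proof (eventually_elim, intro impI)
    fix s assume fin: "(\<Sum>n. ennreal (g s * koopman (u n) g s)) \<noteq> \<infinity>"
      and N: "\<forall>n. s \<notin> P \<longrightarrow> \<phi> (- u n) s \<notin> P"
      and dual: "\<forall>n. dual_op M (\<phi> (u n)) f s = ennreal (cocycle (u n) s * f (\<phi> (- u n) s))"
      and s: "s \<in> space M" and "s \<notin> P"
    have gs: "0 < g s" using f_pos[OF s] \<open>s \<notin> P\<close> by (simp add: g_def)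
    have f_nonneg: "0 \<le> f (\<phi> (- u n) s)" for n
      using f_pos[OF action_in_space[OF s]] by (simp add: less_imp_le)
    have "summable (\<lambda>n. g s * koopman (u n) g s)"
      using fin prod_nonneg[OF s] by (intro summable_suminf_not_top) auto
    \<comment> \<open>Off \<open>P\<close> the factor \<open>g s\<close> is positive and independent
      of \<open>n\<close>, so it can be divided out.\<close>
    then have sum: "summable (\<lambda>n. koopman (u n) g s)"
      using gs by (simp add: summable_cmult_iff)
    have nonneg: "0 \<le> koopman (u n) g s" for n
      using prod_nonneg[OF s, of n] gs by (simp add: zero_le_mult_iff)
    \<comment> \<open>Terms eventually below 1 dominate their squares, which turns summability of
      the square roots into summability of the dual terms.\<close>
    have "\<forall>\<^sub>F n in sequentially. koopman (u n) g s < 1"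
      by (rule order_tendstoD(2)[OF summable_LIMSEQ_zero[OF sum]]) simp
    then have "\<forall>\<^sub>F n in sequentially. norm ((koopman (u n) g s)\<^sup>2) \<le> koopman (u n) g s"
      by eventually_elim (use nonneg in \<open>simp add: power2_eq_square mult_left_le\<close>)
    then have "summable (\<lambda>n. (koopman (u n) g s)\<^sup>2)"
      by (rule summable_comparison_test_ev[OF _ sum])
    \<comment> \<open>Here the orbit must stay off \<open>P\<close>: only there is the square of
      \<open>g\<close> equal to \<open>f\<close>.\<close>
    moreover have "(koopman (u n) g s)\<^sup>2 = cocycle (u n) s * f (\<phi> (- u n) s)" for n
      using N \<open>s \<notin> P\<close> f_nonneg[of n] by (simp add: koopman_def g_def power_mult_distrib)
    ultimately have "summable (\<lambda>n. cocycle (u n) s * f (\<phi> (- u n) s))" by simp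
    then show "(\<Sum>n. dual_op M (\<phi> (u n)) f s) < \<infinity>"
      using dual f_nonneg by (simp add: suminf_ennreal2)
  qed
  then show thesis by (rule that)
qed

end

section \<open>Invariance of the two parts and assembly of the three claims\<close>

theorem mainTheorem2:
  fixes M :: "('s::polish_space) measure"
    and \<phi> :: "'g::{topological_ab_group_add} \<Rightarrow> 's \<Rightarrow> 's"
    and P :: "'s set" and f :: "'s \<Rightarrow> real"
  assumes std: "sets M = sets borel"
    and sf: "sigma_finite_measure M"
    and lc: "locally_compact_space (euclidean :: 'g topology)"
    and act: "nonsingular_action M \<phi>"
    and P: "positive_part M \<phi> P"
    and f_int: "integrable M f"
    and f_pos: "\<forall>s\<in>space M. f s > 0"
  defines "N \<equiv> space M - P"
  shows "(\<forall>t. emeasure M (symdiff (\<phi> t -` P \<inter> space M) P) = 0 \<and>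
              emeasure M (symdiff (\<phi> t -` N \<inter> space M) N) = 0)
       \<and> (\<forall>u :: nat \<Rightarrow> 'g. AE s in M. s \<in> P \<longrightarrow> (\<Sum>n. dual_op M (\<phi> (u n)) f s) = \<infinity>)
       \<and> (\<exists>u :: nat \<Rightarrow> 'g. AE s in M. s \<in> N \<longrightarrow> (\<Sum>n. dual_op M (\<phi> (u n)) f s) < \<infinity>)"
proof -
  interpret sigma_finite_nonsingular_action M \<phi>
    using sf act by (simp add: sigma_finite_nonsingular_action_def sigma_finite_nonsingular_action_axioms_def)
  \<comment> \<open>The maximal set is itself the support of an invariant density, so facts about
    such supports apply to all of \<open>P\<close>.\<close>
  from P obtain h where h [measurable]: "h \<in> borel_measurable M"
    and inv: "density M h \<in> Lambda_inv M \<phi>" and P_eq: "P = {s \<in> space M. 0 < h s}"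
    unfolding positive_part_def I_inv_def by blast
  have P_meas [measurable]: "P \<in> sets M" unfolding P_eq by measurable
  have N_meas [measurable]: "N \<in> sets M" unfolding N_def by measurable
  have P_inv: "AE s in M. \<phi> t s \<in> P \<longleftrightarrow> s \<in> P" for t
    using invariant_support[OF h inv, of t] AE_space
    by eventually_elim (auto simp: P_eq action_in_space)
  have "emeasure M (symdiff (\<phi> t -` P \<inter> space M) P) = 0" for t
  proof -
    have "{s \<in> space M. \<not> (\<phi> t s \<in> P \<longleftrightarrow> s \<in> P)} = symdiff (\<phi> t -` P \<inter> space M) P"
      using sets.sets_into_space[OF P_meas] by (auto simp: symdiff_def)
    moreover have "{s \<in> space M. \<not> (\<phi> t s \<in> P \<longleftrightarrow> s \<in> P)} \<in> sets M" by measurable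
    ultimately show ?thesis
      using AE_iff_measurable[of _ M "\<lambda>s. \<phi> t s \<in> P \<longleftrightarrow> s \<in> P"] P_inv[of t] by auto
  qed
  \<comment> \<open>Passing to complements preserves symmetric differences, as
    \<open>\<phi> t\<close> maps the space into itself.\<close>
  moreover have "symdiff (\<phi> t -` N \<inter> space M) N = symdiff (\<phi> t -` P \<inter> space M) P" for t
    using sets.sets_into_space[OF P_meas] action_in_space[of _ t] by (auto simp: symdiff_def N_def)
  moreover have "AE s in M. s \<in> P \<longrightarrow> (\<Sum>n. dual_op M (\<phi> (u n)) f s) = \<infinity>" for u :: "nat \<Rightarrow> 'g"
    using AE_suminf_dual_op_eq_top[OF h inv borel_measurable_integrable[OF f_int], of u] f_pos
    by (auto simp: P_eq elim!: eventually_mono)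
  moreover obtain u :: "nat \<Rightarrow> 'g" where
    "AE s in M. s \<notin> P \<longrightarrow> (\<Sum>n. dual_op M (\<phi> (u n)) f s) < \<infinity>"
  proof (rule exists_sequence_suminf_dual_op_less_top[OF P _ P_meas f_int])
    show "AE s in M. s \<notin> P \<longrightarrow> \<phi> t s \<notin> P" for t
      using P_inv[of t] by eventually_elim simp
    show "0 < f s" if "s \<in> space M" for s using f_pos that by simp
  qed
  then have "AE s in M. s \<in> N \<longrightarrow> (\<Sum>n. dual_op M (\<phi> (u n)) f s) < \<infinity>"
    by (auto simp: N_def elim!: eventually_mono)
  ultimately show ?thesis by auto
qed

end
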